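(* Let $G$ be a finite simple graph with at least two vertices which is a König–Egerváry graph, i.e. $\alpha(G)+\mu(G)=|V(G)|$. Then $G$ is $\alpha^{++}$-stable if and only if $G$ has a perfect matching consisting only of pendant edges and $G$ contains no cycle on $4$ vertices (that is, no four vertices of $G$ span a subgraph containing a cycle of length $4$).
   Context: All graphs are finite, simple, with at least two vertices. $\alpha(G)$ is the stability number (maximum size of a stable set) and $\mu(G)$ the maximum size of a matching. A pendant edge is an edge $vw$ such that $v$ has exactly one neighbour. For $e\in E(\overline{G})$ (a pair of distinct non-adjacent vertices of $G$), $G+e$ is the graph obtained by adding the edge $e$. $G$ is $\alpha^{++}$-stable if $\alpha(G+e_1+e_2)=\alpha(G)$ for any $e_1,e_2\in E(\overline{G})$ (not necessarily distinct). *)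

theory Defs
  imports "HOL-Library.Ramsey" "HOL-Library.Disjoint_Sets"
begin

text \<open>
  A graph is a vertex set \<open>V\<close> together with a set \<open>E\<close> of two-element subsets of \<open>V\<close>.
  Stable sets are the library's \<^const>\<open>indep\<close> sets.
\<close>

definition fin_simple_graph :: "'a set \<Rightarrow> 'a set set \<Rightarrow> bool" where
  "fin_simple_graph V E \<longleftrightarrow> finite V \<and> E \<subseteq> [V]\<^bsup>2\<^esup>"

definition stability_number :: "'a set \<Rightarrow> 'a set set \<Rightarrow> nat" where
  "stability_number V E = Max {card S | S. S \<subseteq> V \<and> indep S E}"

definition matching :: "'a set set \<Rightarrow> 'a set set \<Rightarrow> bool" where
  "matching E M \<longleftrightarrow> M \<subseteq> E \<and> disjoint M"

definition matching_number :: "'a set set \<Rightarrow> nat" where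
  "matching_number E = Max {card M | M. matching E M}"

definition perfect_matching :: "'a set \<Rightarrow> 'a set set \<Rightarrow> 'a set set \<Rightarrow> bool" where
  "perfect_matching V E M \<longleftrightarrow> matching E M \<and> \<Union>M = V"

definition neighbours :: "'a set set \<Rightarrow> 'a \<Rightarrow> 'a set" where
  "neighbours E v = {w. {v, w} \<in> E}"

definition pendant_edge :: "'a set set \<Rightarrow> 'a set \<Rightarrow> bool" where
  "pendant_edge E e \<longleftrightarrow> e \<in> E \<and> (\<exists>v\<in>e. card (neighbours E v) = 1)"

definition koenig_egervary :: "'a set \<Rightarrow> 'a set set \<Rightarrow> bool" where
  "koenig_egervary V E \<longleftrightarrow> stability_number V E + matching_number E = card V"

definition complement_edges :: "'a set \<Rightarrow> 'a set set \<Rightarrow> 'a set set" where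
  "complement_edges V E = [V]\<^bsup>2\<^esup> - E"

definition alpha_pp_stable :: "'a set \<Rightarrow> 'a set set \<Rightarrow> bool" where
  "alpha_pp_stable V E \<longleftrightarrow>
    (\<forall>e\<^sub>1\<in>complement_edges V E. \<forall>e\<^sub>2\<in>complement_edges V E.
       stability_number V (E \<union> {e\<^sub>1, e\<^sub>2}) = stability_number V E)"

text \<open>Cycles are not required to be induced: chords are allowed.\<close>

definition is_cycle :: "'a set set \<Rightarrow> 'a list \<Rightarrow> bool" where
  "is_cycle E vs \<longleftrightarrow> length vs \<ge> 3 \<and> distinct vs \<and>
    (\<forall>i<length vs. {vs ! i, vs ! (Suc i mod length vs)} \<in> E)"

end

theory Submission
  imports Defs
begin

text \<open>
  In a Koenig-Egervary graph, a maximum stable set contains every vertex missed by a given maximum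
  matching and exactly one end of each matching edge. Under \<open>\<alpha>\<^sup>+\<^sup>+\<close>-stability there are no two pairs
  of vertices such that every maximum stable set contains one of them. An unmatched vertex \<open>a\<close> would
  give such pairs \<open>{a, x}\<close>, \<open>{a, y}\<close> for a matching edge \<open>xy\<close>; a non-pendant matching edge \<open>xy\<close>
  with further neighbours \<open>u\<close> of \<open>x\<close> and \<open>v\<close> of \<open>y\<close> gives \<open>{x, u'}\<close>, \<open>{y, v'}\<close>, where the prime
  denotes the matching partner; and a 4-cycle \<open>abcd\<close> gives \<open>{a', c'}\<close>, \<open>{b', d'}\<close>.
  Conversely, the leaves of a pendant perfect matching form a maximum stable set, and if there is
  no 4-cycle, at most two leaves can be replaced by their partners so as to avoid two given
  non-edges.
\<close>

section \<open>Extremal stable sets and matchings, and basic facts on edges\<close>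

definition max_stable :: "'a set \<Rightarrow> 'a set set \<Rightarrow> 'a set \<Rightarrow> bool" where
  "max_stable V E S \<longleftrightarrow> S \<subseteq> V \<and> indep S E \<and> card S = stability_number V E"

lemma finite_stable_cards:
  assumes "finite V"
  shows "finite {card S | S. S \<subseteq> V \<and> indep S E}"
  using assms by (auto intro: finite_subset[of _ "card ` Pow V"])

lemma card_le_stability_number:
  assumes "finite V" "S \<subseteq> V" "indep S E"
  shows "card S \<le> stability_number V E"
  unfolding stability_number_def
  by (rule Max_ge) (use assms finite_stable_cards in auto)

lemma max_stable_exists:
  assumes "finite V"
  shows "\<exists>S. max_stable V E S"
proof -
  have "card {} \<in> {card S | S. S \<subseteq> V \<and> indep S E}"
    by (force simp: indep_def)
  then have "stability_number V E \<in> {card S | S. S \<subseteq> V \<and> indep S E}"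
    unfolding stability_number_def
    using Max_in finite_stable_cards[OF assms] by blast
  then show ?thesis
    by (auto simp: max_stable_def)
qed

lemma maximum_matching_exists:
  assumes "finite E"
  shows "\<exists>M. matching E M \<and> card M = matching_number E"
proof -
  have "finite {card M | M. matching E M}"
    by (rule finite_subset[of _ "card ` Pow E"]) (use assms in \<open>auto simp: matching_def\<close>)
  moreover have "card {} \<in> {card M | M. matching E M}"
    by (force simp: matching_def disjoint_def)
  ultimately have "matching_number E \<in> {card M | M. matching E M}"
    unfolding matching_number_def using Max_in by blast
  then show ?thesis
    by auto
qed

lemma edge_subset:
  assumes "fin_simple_graph V E" "e \<in> E"
  shows "e \<subseteq> V"
  using assms by (auto simp: fin_simple_graph_def nsets_def)

lemma edge_ends:
  assumes "fin_simple_graph V E" "{x, y} \<in> E"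
  shows "x \<in> V" "y \<in> V" "x \<noteq> y"
proof -
  have "{x, y} \<in> [V]\<^bsup>2\<^esup>"
    using assms unfolding fin_simple_graph_def by blast
  then show "x \<in> V" "y \<in> V" "x \<noteq> y"
    by simp_all
qed

lemma edge_pairE:
  assumes "fin_simple_graph V E" "e \<in> E"
  obtains x y where "e = {x, y}" "x \<noteq> y" "x \<in> V" "y \<in> V"
  using assms nsets2_E[of e V] unfolding fin_simple_graph_def by blast

lemma matching_edge_unique:
  assumes "matching E M" "e \<in> M" "e' \<in> M" "x \<in> e" "x \<in> e'"
  shows "e = e'"
  using assms by (auto simp: matching_def disjoint_def)

section \<open>Stable sets against matchings in Koenig-Egervary graphs\<close>

text \<open>Every matching edge has an end outside the stable set \<open>S\<close>; choosing one
  gives an injection \<open>g\<close> of \<open>M\<close> into \<open>V - S\<close>. The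
  Koenig-Egervary equality makes both sets equally large, so \<open>g\<close> is onto: nothing
  outside \<open>S\<close> is unmatched.\<close>

lemma max_stable_splits_maximum_matching:
  assumes graph: "fin_simple_graph V E" and ke: "koenig_egervary V E"
    and M: "matching E M" "card M = matching_number E"
    and S: "max_stable V E S"
  shows max_stable_contains_unmatched: "v \<in> V \<Longrightarrow> v \<notin> \<Union>M \<Longrightarrow> v \<in> S"
    and max_stable_one_end: "{x, y} \<in> M \<Longrightarrow> x \<in> S \<longleftrightarrow> y \<notin> S"
proof -
  have fin: "finite V"
    using graph by (auto simp: fin_simple_graph_def)
  have ME: "M \<subseteq> E"
    using M by (simp add: matching_def)
  have SV: "S \<subseteq> V" and ind: "indep S E"
    using S by (auto simp: max_stable_def)
  have "\<exists>x. x \<in> e \<and> x \<notin> S" if e: "e \<in> M" for e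
  proof -
    obtain a b where "e = {a, b}" "a \<noteq> b"
      using edge_pairE[OF graph] e ME by blast
    then show ?thesis
      using ind e ME by (auto simp: indep_def)
  qed
  then obtain g where g: "\<And>e. e \<in> M \<Longrightarrow> g e \<in> e \<and> g e \<notin> S"
    by metis
  have inj: "inj_on g M"
    by (rule inj_onI) (metis g matching_edge_unique[OF M(1)])
  have "\<Union>M \<subseteq> V"
    using ME edge_subset[OF graph] by blast
  then have "g ` M \<subseteq> V - S"
    using g by blast
  moreover have "card (g ` M) = card (V - S)"
    using ke S M(2) card_image[OF inj] card_Diff_subset[OF finite_subset[OF SV fin] SV]
    by (simp add: koenig_egervary_def max_stable_def)
  ultimately have onto: "g ` M = V - S"
    by (intro card_subset_eq finite_Diff fin)
  show "v \<in> S" if "v \<in> V" "v \<notin> \<Union>M"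
  proof (rule ccontr)
    assume "v \<notin> S"
    then have "v \<in> g ` M"
      using that(1) by (simp add: onto)
    then obtain e where "e \<in> M" "v = g e"
      by blast
    then show False
      using g that(2) by blast
  qed
  show "x \<in> S \<longleftrightarrow> y \<notin> S" if xy: "{x, y} \<in> M"
  proof -
    have ed: "{x, y} \<in> E" "x \<noteq> y" "x \<in> V" "y \<in> V"
      using xy ME edge_ends[OF graph, of x y] by auto
    \<comment> \<open>If both ends were outside \<open>S\<close>, both would equal
      \<open>g {x, y}\<close>, although \<open>x \<noteq> y\<close>.\<close>
    have "g {x, y} = z" if "z \<in> {x, y}" "z \<notin> S" for z
    proof -
      have "z \<in> g ` M"
        using ed that by (auto simp: onto)
      then obtain e where e: "e \<in> M" "z = g e"
        by blast
      then have "e = {x, y}"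
        using matching_edge_unique[OF M(1) e(1) xy, of z] g[OF e(1)] that e by simp
      then show ?thesis
        using e by simp
    qed
    then have "x \<in> S \<or> y \<in> S"
      using ed(2) by (metis insertCI)
    then show ?thesis
      using ind ed by (auto simp: indep_def)
  qed
qed

section \<open>Forward direction: avoiding two pairs of vertices\<close>

text \<open>Join each of the two pairs by an edge. The stability number is unchanged, so a maximum
  stable set of the larger graph is still maximum in the original one, and it contains neither
  pair.\<close>

lemma alpha_pp_stable_avoids_pairs:
  assumes "finite V" and app: "alpha_pp_stable V E"
    and pq: "p \<in> V" "q \<in> V" "p \<noteq> q" and rs: "r \<in> V" "s \<in> V" "r \<noteq> s"
  shows "\<exists>S. max_stable V E S \<and> \<not> {p, q} \<subseteq> S \<and> \<not> {r, s} \<subseteq> S"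
proof -
  have nonedge: "e \<in> complement_edges V E" if "e \<notin> E" "e \<in> {{p, q}, {r, s}}" for e
    using that pq rs by (auto simp: complement_edges_def nsets_def)
  have "\<exists>F. {{p, q}, {r, s}} \<subseteq> E \<union> F \<and> stability_number V (E \<union> F) = stability_number V E"
  \<comment> \<open>The stability hypothesis speaks of non-edges only, so pairs that are already
    edges are left out of \<open>F\<close>; a single remaining non-edge is passed twice.\<close>
  proof (cases "{p, q} \<in> E"; cases "{r, s} \<in> E")
    assume "{p, q} \<in> E" "{r, s} \<in> E"
    then show ?thesis
      by (intro exI[of _ "{}"]) auto
  next
    assume "{p, q} \<in> E" "{r, s} \<notin> E"
    then show ?thesis
      using app[unfolded alpha_pp_stable_def, rule_format, of "{r, s}" "{r, s}"] nonedge[of "{r, s}"]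
      by (intro exI[of _ "{{r, s}}"]) auto
  next
    assume "{p, q} \<notin> E" "{r, s} \<in> E"
    then show ?thesis
      using app[unfolded alpha_pp_stable_def, rule_format, of "{p, q}" "{p, q}"] nonedge[of "{p, q}"]
      by (intro exI[of _ "{{p, q}}"]) auto
  next
    assume "{p, q} \<notin> E" "{r, s} \<notin> E"
    then show ?thesis
      using app nonedge[of "{p, q}"] nonedge[of "{r, s}"]
      by (intro exI[of _ "{{p, q}, {r, s}}"]) (auto simp: alpha_pp_stable_def)
  qed
  then obtain F where F: "{p, q} \<in> E \<union> F" "{r, s} \<in> E \<union> F"
    "stability_number V (E \<union> F) = stability_number V E"
    by auto
  obtain S where S: "max_stable V (E \<union> F) S"
    using max_stable_exists[OF \<open>finite V\<close>] by blast
  then have "max_stable V E S"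
    using F by (auto simp: max_stable_def indep_def)
  moreover have "\<not> {p, q} \<subseteq> S" "\<not> {r, s} \<subseteq> S"
    using S F pq rs by (auto simp: max_stable_def indep_def)
  ultimately show ?thesis
    by blast
qed

lemma perfect_matching_of_alpha_pp_stable:
  assumes graph: "fin_simple_graph V E" and "card V \<ge> 2" and ke: "koenig_egervary V E"
    and app: "alpha_pp_stable V E"
    and M: "matching E M" "card M = matching_number E"
  shows "perfect_matching V E M"
proof -
  have fin: "finite V"
    using graph by (auto simp: fin_simple_graph_def)
  have ME: "M \<subseteq> E"
    using M by (simp add: matching_def)
  have sub: "\<Union>M \<subseteq> V"
    using ME edge_subset[OF graph] by blast
  note unm = max_stable_contains_unmatched[OF graph ke M]
  note one = max_stable_one_end[OF graph ke M]
  note avoid = alpha_pp_stable_avoids_pairs[OF fin app]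
  have False if a: "a \<in> V" "a \<notin> \<Union>M" for a
  proof -
    have "\<not> V \<subseteq> {a}"
      using \<open>card V \<ge> 2\<close> card_mono[of "{a}" V] by auto
    then obtain b where b: "b \<in> V" "b \<noteq> a"
      by blast
    show False
    proof (cases "b \<in> \<Union>M")
      case False
      \<comment> \<open>Two unmatched vertices lie together in every maximum stable set, so the one
        pair \<open>{a, b}\<close>, taken twice, suffices.\<close>
      then show False
        using avoid[of a b a b] a b unm by blast
    next
      case True
      then obtain e where e: "e \<in> M" "b \<in> e"
        by blast
      then obtain x y where xy: "e = {x, y}"
        using edge_pairE[OF graph] ME by blast
      then have "x \<in> V" "y \<in> V" "x \<noteq> a" "y \<noteq> a"
        using e sub a by auto
      then obtain S where "max_stable V E S" "\<not> {a, x} \<subseteq> S" "\<not> {a, y} \<subseteq> S"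
        using avoid[of a x a y] a by metis
      then show False
        using unm[of S a] one[of S x y] a e xy by auto
    qed
  qed
  then show ?thesis
    using M sub by (auto simp: perfect_matching_def)
qed

text \<open>A perfect matching is turned into a fixed-point-free involution, so that both directions
  can name partners directly.\<close>

lemma perfect_matching_partner:
  assumes graph: "fin_simple_graph V E" and M: "perfect_matching V E M"
  obtains m where "\<And>v. v \<in> V \<Longrightarrow> {v, m v} \<in> M" "\<And>v. v \<in> V \<Longrightarrow> m v \<in> V"
    "\<And>v. v \<in> V \<Longrightarrow> m v \<noteq> v" "\<And>v. v \<in> V \<Longrightarrow> m (m v) = v"
proof -
  have mat: "matching E M" and ME: "M \<subseteq> E" and cover: "\<Union>M = V"
    using M by (auto simp: perfect_matching_def matching_def)
  have "\<exists>w. {v, w} \<in> M" if v: "v \<in> V" for v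
  proof -
    obtain e where e: "e \<in> M" "v \<in> e"
      using v cover by blast
    then obtain x y where "e = {x, y}"
      using edge_pairE[OF graph] ME by blast
    then show ?thesis
      using e by (auto simp: insert_commute)
  qed
  then obtain m where m: "\<And>v. v \<in> V \<Longrightarrow> {v, m v} \<in> M"
    by metis
  have ne: "m v \<noteq> v" if v: "v \<in> V" for v
    using m[OF v] ME edge_ends(3)[OF graph, of v "m v"] by auto
  have mV: "m v \<in> V" if v: "v \<in> V" for v
    using m[OF v] cover by blast
  have "m (m v) = v" if v: "v \<in> V" for v
  proof -
    have "{m v, m (m v)} = {v, m v}"
      using matching_edge_unique[OF mat m[OF mV[OF v]] m[OF v]] by blast
    then show ?thesis
      using ne[OF v] ne[OF mV[OF v]] by (auto simp: doubleton_eq_iff)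
  qed
  with m mV ne show thesis
    using that by blast
qed

lemma is_cycle_4_iff:
  "is_cycle E [a, b, c, d] \<longleftrightarrow>
    distinct [a, b, c, d] \<and> {a, b} \<in> E \<and> {b, c} \<in> E \<and> {c, d} \<in> E \<and> {d, a} \<in> E"
proof -
  have "(\<forall>i<4. P i) \<longleftrightarrow> P 0 \<and> P (Suc 0) \<and> P (Suc (Suc 0)) \<and> P (Suc (Suc (Suc 0)))"
    for P :: "nat \<Rightarrow> bool"
    by (simp add: eval_nat_numeral less_Suc_eq_0_disj) blast
  note all4 = this[of "\<lambda>i. {[a, b, c, d] ! i, [a, b, c, d] ! (Suc i mod 4)} \<in> E"]
  have "length [a, b, c, d] = 4"
    by simp
  then show ?thesis
    unfolding is_cycle_def using all4 by (simp del: list.size)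
qed

lemma pendant_and_C4_free_of_alpha_pp_stable:
  assumes graph: "fin_simple_graph V E" and "card V \<ge> 2" and ke: "koenig_egervary V E"
    and app: "alpha_pp_stable V E"
  shows "(\<exists>M. perfect_matching V E M \<and> (\<forall>e\<in>M. pendant_edge E e)) \<and>
    \<not> (\<exists>vs. is_cycle E vs \<and> length vs = 4)"
proof -
  have fin: "finite V" and E: "E \<subseteq> [V]\<^bsup>2\<^esup>"
    using graph by (auto simp: fin_simple_graph_def)
  have "finite E"
    using E fin by (meson finite_imp_finite_nsets finite_subset)
  then obtain M where M: "matching E M" "card M = matching_number E"
    using maximum_matching_exists by blast
  have pm: "perfect_matching V E M"
    using perfect_matching_of_alpha_pp_stable assms M by blast
  have ME: "M \<subseteq> E"
    using M by (simp add: matching_def)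
  obtain m where m: "\<And>v. v \<in> V \<Longrightarrow> {v, m v} \<in> M" and mV: "\<And>v. v \<in> V \<Longrightarrow> m v \<in> V"
    and mne: "\<And>v. v \<in> V \<Longrightarrow> m v \<noteq> v" and mm: "\<And>v. v \<in> V \<Longrightarrow> m (m v) = v"
    using perfect_matching_partner[OF graph pm] by blast
  have one: "v \<in> S \<longleftrightarrow> m v \<notin> S" if "max_stable V E S" "v \<in> V" for S v
    using max_stable_one_end[OF graph ke M that(1) m[OF that(2)]] .
  note edge = edge_ends[OF graph]
  have adj: "x \<notin> S \<or> y \<notin> S" if "max_stable V E S" "{x, y} \<in> E" for S x y
    using that edge[OF that(2)] by (auto simp: max_stable_def indep_def)
  note avoid = alpha_pp_stable_avoids_pairs[OF fin app]
  have "pendant_edge E e" if e: "e \<in> M" for e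
  proof (rule ccontr)
    assume np: "\<not> pendant_edge E e"
    obtain x where x: "x \<in> e" "x \<in> V"
      using edge_pairE[OF graph, of e] e ME by blast
    define y where "y = m x"
    have exy: "e = {x, y}"
      using matching_edge_unique[OF M(1) e m[OF x(2)] x(1)] by (simp add: y_def)
    have y: "y \<in> V" "y \<noteq> x" "m y = x"
      using mV[OF x(2)] mne[OF x(2)] mm[OF x(2)] by (auto simp: y_def)
    have other: "\<exists>u. {v, u} \<in> E \<and> u \<noteq> w" if "v \<in> e" "{v, w} \<in> E" for v w
    proof (rule ccontr)
      assume "\<nexists>u. {v, u} \<in> E \<and> u \<noteq> w"
      then have "neighbours E v = {w}"
        using that unfolding neighbours_def by blast
      then have "card (neighbours E v) = 1"
        by simp
      then show False
        using np that(1) e ME unfolding pendant_edge_def by blast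
    qed
    have xyE: "{x, y} \<in> E" "{y, x} \<in> E"
      using e exy ME by (auto simp: insert_commute)
    obtain u v where u: "{x, u} \<in> E" "u \<noteq> y" and v: "{y, v} \<in> E" "v \<noteq> x"
      using other[of x y] other[of y x] xyE exy by blast
    have uV: "u \<in> V" and vV: "v \<in> V"
      using edge u v by blast+
    \<comment> \<open>The pairs to be avoided must consist of distinct vertices;
      \<open>m u = x\<close> would give \<open>u = y\<close>.\<close>
    have "m u \<noteq> x" "m v \<noteq> y"
      using u v uV vV mm y_def y by metis+
    then obtain S where S: "max_stable V E S" "\<not> {x, m u} \<subseteq> S" "\<not> {y, m v} \<subseteq> S"
      using avoid[of x "m u" y "m v"] x y uV vV mV by metis
    \<comment> \<open>If \<open>x \<in> S\<close>, then \<open>u \<notin> S\<close> and so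
      \<open>m u \<in> S\<close>, against the first pair. Hence \<open>y \<in> S\<close>, and in the
      same way \<open>m v \<in> S\<close>, against the second.\<close>
    then show False
      using one[OF S(1)] adj[OF S(1)] x(2) y uV vV u v y_def by blast
  qed
  moreover have False if cyc: "is_cycle E vs" and len: "length vs = 4" for vs
  proof -
    obtain a b c d where vs: "vs = [a, b, c, d]"
      using len by (auto simp: numeral_eq_Suc length_Suc_conv)
    have c4: "{a, b} \<in> E" "{b, c} \<in> E" "{c, d} \<in> E" "{d, a} \<in> E" and dist: "a \<noteq> c" "b \<noteq> d"
      using cyc by (auto simp: vs is_cycle_4_iff)
    have inV: "a \<in> V" "b \<in> V" "c \<in> V" "d \<in> V"
      using c4 edge by blast+
    have "m a \<noteq> m c" "m b \<noteq> m d"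
      using dist inV mm by metis+
    then obtain S where S: "max_stable V E S" "\<not> {m a, m c} \<subseteq> S" "\<not> {m b, m d} \<subseteq> S"
      using avoid[of "m a" "m c" "m b" "m d"] inV mV by metis
    \<comment> \<open>Avoiding \<open>{m a, m c}\<close> puts \<open>a\<close> or \<open>c\<close>
      into \<open>S\<close>, and avoiding \<open>{m b, m d}\<close> puts \<open>b\<close> or
      \<open>d\<close> there; each of the former is adjacent to each of the latter.\<close>
    then show False
      using one[OF S(1)] adj[OF S(1)] c4 inV by blast
  qed
  ultimately show ?thesis
    using pm by blast
qed

section \<open>Converse: exchanging leaves with their partners\<close>

text \<open>The involution maps any stable set injectively into its complement, which bounds its
  size by half of \<open>V\<close>; a stable set meeting every pair \<open>{v, m v}\<close> attains
  the bound. The value depends on \<open>V\<close> alone, which allows comparing a graph with its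
  extensions by new edges.\<close>

lemma stability_number_of_transversal:
  assumes fin: "finite V"
    and m: "\<And>v. v \<in> V \<Longrightarrow> {v, m v} \<in> E" "\<And>v. v \<in> V \<Longrightarrow> m v \<in> V"
    "\<And>v. v \<in> V \<Longrightarrow> m v \<noteq> v" "\<And>v. v \<in> V \<Longrightarrow> m (m v) = v"
    and T: "T \<subseteq> V" "indep T E" "\<And>v. v \<in> V \<Longrightarrow> v \<notin> T \<Longrightarrow> m v \<in> T"
  shows "stability_number V E = card V div 2"
proof -
  have cm: "card (m ` S) = card S" "finite S" if "S \<subseteq> V" for S
    using that m(4) fin by (auto intro!: card_image inj_onI finite_subset[of S V]) (metis subsetD)
  obtain S where S: "max_stable V E S"
    using max_stable_exists[OF fin] by blast
  then have SV: "S \<subseteq> V" and ind: "indep S E"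
    by (auto simp: max_stable_def)
  have "m ` S \<subseteq> V - S"
    using SV ind m by (auto simp: indep_def) (metis subsetD)
  then have "card S \<le> card (V - S)"
    using card_mono[of "V - S" "m ` S"] fin cm[OF SV] by simp
  then have up: "2 * stability_number V E \<le> card V"
    using S SV card_Diff_subset[of S V] cm[OF SV] card_mono[OF fin SV] by (simp add: max_stable_def)
  have "V - T \<subseteq> m ` T"
    using T(3) m(4) by (metis DiffE image_eqI subsetI)
  then have "card (V - T) \<le> card T"
    using card_mono[of "m ` T" "V - T"] cm[OF T(1)] by simp
  then have "card V \<le> 2 * card T"
    using card_Diff_subset[of T V] cm[OF T(1)] T(1) by simp
  moreover have "card T \<le> stability_number V E"
    using card_le_stability_number fin T by blast
  ultimately show ?thesis
    using up by simp
qed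

lemma alpha_pp_stable_of_pendant_and_C4_free:
  assumes graph: "fin_simple_graph V E"
    and pm: "perfect_matching V E M" and pend: "\<forall>e\<in>M. pendant_edge E e"
    and noC4: "\<not> (\<exists>vs. is_cycle E vs \<and> length vs = 4)"
  shows "alpha_pp_stable V E"
proof -
  have fin: "finite V"
    using graph by (auto simp: fin_simple_graph_def)
  have mat: "matching E M" and ME: "M \<subseteq> E"
    using pm by (auto simp: perfect_matching_def matching_def)
  obtain m where m: "\<And>v. v \<in> V \<Longrightarrow> {v, m v} \<in> M" and mV: "\<And>v. v \<in> V \<Longrightarrow> m v \<in> V"
    and mne: "\<And>v. v \<in> V \<Longrightarrow> m v \<noteq> v" and mm: "\<And>v. v \<in> V \<Longrightarrow> m (m v) = v"
    using perfect_matching_partner[OF graph pm] by blast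
  have mE: "{v, m v} \<in> E" if "v \<in> V" for v
    using m that ME by blast
  note edge = edge_ends[OF graph]
  have "\<forall>e\<in>M. \<exists>v. v \<in> e \<and> card (neighbours E v) = 1"
    using pend by (auto simp: pendant_edge_def)
  then obtain f where f: "\<And>e. e \<in> M \<Longrightarrow> f e \<in> e \<and> card (neighbours E (f e)) = 1"
    by metis
  \<comment> \<open>Only one chosen leaf per matching edge: if both ends have degree 1, just one of
    them enters \<open>L\<close>.\<close>
  define L where "L = f ` M"
  have LV: "L \<subseteq> V"
    using f ME edge_subset[OF graph] unfolding L_def by blast
  have leaf: "w = m v" if "v \<in> L" "{v, w} \<in> E" for v w
  proof -
    have "card (neighbours E v) = 1"
      using that f by (auto simp: L_def)
    moreover have "w \<in> neighbours E v" "m v \<in> neighbours E v"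
      using that mE LV by (auto simp: neighbours_def)
    ultimately show ?thesis
      by (metis card_1_singletonE singletonD)
  qed
  have L: "v \<in> L \<longleftrightarrow> m v \<notin> L" if v: "v \<in> V" for v
  proof -
    have "z \<in> L \<longleftrightarrow> z = f {v, m v}" if "z \<in> {v, m v}" for z
    proof
      assume "z \<in> L"
      then obtain e where e: "e \<in> M" "z = f e"
        by (auto simp: L_def)
      then show "z = f {v, m v}"
        using matching_edge_unique[OF mat e(1) m[OF v], of z] f that by auto
    qed (use m[OF v] in \<open>auto simp: L_def\<close>)
    moreover have "f {v, m v} \<in> {v, m v}"
      using f m[OF v] by blast
    ultimately show ?thesis
      using mne[OF v] by (metis insertE insertI1 insertI2 singletonD)
  qed
  \<comment> \<open>Leaves are only adjacent to their partners, so replacing some leaves by their partners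
      keeps \<open>L\<close> stable as soon as these partners are pairwise non-adjacent.\<close>
  define swap where "swap T = (L - T) \<union> m ` T" for T
  have swap: "swap T \<subseteq> V" "\<And>v. v \<in> V \<Longrightarrow> v \<notin> swap T \<Longrightarrow> m v \<in> swap T"
    "indep (swap T) E" if T: "T \<subseteq> L" "indep (m ` T) E" for T
  proof -
    show "swap T \<subseteq> V"
      using T LV mV by (auto simp: swap_def)
    show "m v \<in> swap T" if "v \<in> V" "v \<notin> swap T" for v
      using that L mm by (auto simp: swap_def) (metis image_eqI)
    have *: "{v, w} \<notin> E" if v: "v \<in> L - T" and w: "w \<in> swap T" for v w
    proof
      assume "{v, w} \<in> E"
      then have wv: "w = m v"
        using leaf v by blast
      then have "w \<notin> L"
        using L v LV by blast
      then obtain t where "t \<in> T" "w = m t"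
        using w by (auto simp: swap_def)
      then show False
        using wv v mm LV T by (metis DiffD1 DiffD2 subsetD)
    qed
    show "indep (swap T) E"
      unfolding indep_def
    proof (intro ballI impI)
      fix v w
      assume vw: "v \<in> swap T" "w \<in> swap T" "v \<noteq> w"
      show "{v, w} \<notin> E"
        using vw *[of v w] *[of w v] T(2)
        by (auto simp: swap_def indep_def insert_commute)
    qed
  qed
  \<comment> \<open>New edges not contained in \<open>swap T\<close> leave it stable, so it remains
    a transversal of the required kind.\<close>
  have alpha: "stability_number V (E \<union> F) = card V div 2"
    if T: "T \<subseteq> L" "indep (m ` T) E" and F: "\<And>e. e \<in> F \<Longrightarrow> \<not> e \<subseteq> swap T" for F T
  proof (rule stability_number_of_transversal[OF fin, of m _ "swap T"])
    show "indep (swap T) (E \<union> F)"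
      using swap(3)[OF T] F[of "{_, _}"] by (auto simp: indep_def)
  qed (use swap[OF T] mE mV mne mm in auto)
  have alphaE: "stability_number V E = card V div 2"
    using alpha[of "{}" "{}"] by (simp add: indep_def)
  \<comment> \<open>If neither non-edge lies in \<open>L\<close>, the choice \<open>T = {}\<close>
    works; by symmetry it remains to treat \<open>e\<^sub>1 \<subseteq> L\<close>.\<close>
  have pick: "\<exists>T\<subseteq>L. indep (m ` T) E \<and> \<not> e\<^sub>1 \<subseteq> swap T \<and> \<not> e\<^sub>2 \<subseteq> swap T"
    if e1: "e\<^sub>1 \<in> [V]\<^bsup>2\<^esup>" "e\<^sub>1 \<subseteq> L" and e2: "e\<^sub>2 \<in> [V]\<^bsup>2\<^esup>" for e\<^sub>1 e\<^sub>2
  proof -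
    obtain p q where pq: "e\<^sub>1 = {p, q}" "p \<noteq> q"
      using e1 by (auto simp: nsets_2_eq)
    obtain r s where rs: "e\<^sub>2 = {r, s}" "r \<noteq> s"
      using e2 by (auto simp: nsets_2_eq)
    have pqL: "p \<in> L" "q \<in> L"
      using e1 pq by auto
    have mL: "m v \<notin> L" if "v \<in> L" for v
      using L LV that by blast
    have inj: "m v \<noteq> m w" if "v \<in> L" "w \<in> L" "v \<noteq> w" for v w
      using that mm LV by (metis subsetD)
    show ?thesis
    proof (cases "e\<^sub>2 \<subseteq> L")
      case False
      have single: "indep (m ` {v}) E" for v
        by (simp add: indep_def)
      have nsub: "\<not> e\<^sub>1 \<subseteq> swap {p}" "\<not> e\<^sub>1 \<subseteq> swap {q}"
        using pq pqL mL[of p] mL[of q] by (auto simp: swap_def)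
      \<comment> \<open>A vertex of \<open>e\<^sub>2\<close> outside \<open>L\<close> can enter
        \<open>swap {p}\<close> only as \<open>m p\<close> and \<open>swap {q}\<close> only as
        \<open>m q\<close>, and these differ.\<close>
      have "\<not> e\<^sub>2 \<subseteq> swap {p} \<or> \<not> e\<^sub>2 \<subseteq> swap {q}"
        using False inj[OF pqL pq(2)] mL pqL by (auto simp: swap_def)
      then show ?thesis
        using single nsub pqL by (metis empty_subsetI insert_subset)
    next
      case True
      then have rsL: "r \<in> L" "s \<in> L"
        using rs by auto
      \<comment> \<open>One leaf from each non-edge is to be swapped. If all four choices had
        adjacent partners, these would form a 4-cycle. A common leaf \<open>x = y\<close> is
        allowed: \<open>{m x, m x}\<close> is no edge.\<close>
      have "\<exists>x\<in>{p, q}. \<exists>y\<in>{r, s}. {m x, m y} \<notin> E"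
      proof (rule ccontr)
        assume neg: "\<not> ?thesis"
        then have edges: "{m p, m r} \<in> E" "{m r, m q} \<in> E" "{m q, m s} \<in> E" "{m s, m p} \<in> E"
          by (metis insertCI insert_commute)+
        have "is_cycle E [m p, m r, m q, m s]"
          using edges edge(3)[OF edges(1)] edge(3)[OF edges(2)] edge(3)[OF edges(3)]
            edge(3)[OF edges(4)] inj[OF pqL pq(2)] inj[OF rsL rs(2)]
          by (simp add: is_cycle_4_iff)
        moreover have "length [m p, m r, m q, m s] = 4"
          by simp
        ultimately show False
          using noC4 by blast
      qed
      then obtain x y where xy: "x \<in> e\<^sub>1" "y \<in> e\<^sub>2" "{m x, m y} \<notin> E"
        using pq rs by blast
      have "indep (m ` {x, y}) E"
        using xy by (auto simp: indep_def insert_commute)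
      moreover have "{x, y} \<subseteq> L"
        using xy e1 True by auto
      moreover have "x \<notin> swap {x, y}" "y \<notin> swap {x, y}"
        using mL[of x] mL[of y] calculation(2) by (auto simp: swap_def)
      ultimately show ?thesis
        using xy by blast
    qed
  qed
  have "stability_number V (E \<union> {e\<^sub>1, e\<^sub>2}) = card V div 2"
    if e: "e\<^sub>1 \<in> complement_edges V E" "e\<^sub>2 \<in> complement_edges V E" for e\<^sub>1 e\<^sub>2
  proof -
    have n2: "e\<^sub>1 \<in> [V]\<^bsup>2\<^esup>" "e\<^sub>2 \<in> [V]\<^bsup>2\<^esup>"
      using e by (auto simp: complement_edges_def)
    have "\<exists>T\<subseteq>L. indep (m ` T) E \<and> \<not> e\<^sub>1 \<subseteq> swap T \<and> \<not> e\<^sub>2 \<subseteq> swap T"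
    proof (cases "e\<^sub>1 \<subseteq> L \<or> e\<^sub>2 \<subseteq> L")
      case True
      then show ?thesis
        using pick n2 by metis
    next
      case False
      then show ?thesis
        by (intro exI[of _ "{}"]) (auto simp: swap_def indep_def)
    qed
    then show ?thesis
      using alpha[of _ "{e\<^sub>1, e\<^sub>2}"] by blast
  qed
  then show ?thesis
    using alphaE by (simp add: alpha_pp_stable_def)
qed

theorem theorem5:
  fixes V :: "'a set" and E :: "'a set set"
  assumes "fin_simple_graph V E" and "card V \<ge> 2" and "koenig_egervary V E"
  shows "alpha_pp_stable V E \<longleftrightarrow>
    (\<exists>M. perfect_matching V E M \<and> (\<forall>e\<in>M. pendant_edge E e)) \<and>
    \<not> (\<exists>vs. is_cycle E vs \<and> length vs = 4)"
  using pendant_and_C4_free_of_alpha_pp_stable[OF assms]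
    alpha_pp_stable_of_pendant_and_C4_free[OF assms(1)]
  by blast

end
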